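(* Let $G$ be a finitely generated group, with Alexander invariant $B(G)$, and let $\Bbbk$ be a field of characteristic $0$. If $B_{\Bbbk}(G)=B(G)\otimes\Bbbk$ has trivial $G_{\mathrm{ab}}$-action, then $\mathrm{gr}^3_\Gamma(G)\otimes\Bbbk=0$.
   Context: $B(G)=G'/G''$, where $G'=(G,G)$ and $G''=(G',G')$, is a module over $\mathbb{Z}G_{\mathrm{ab}}$, $G_{\mathrm{ab}}=G/G'$, via $\bar h\cdot\bar g=\overline{hgh^{-1}}$ for $h\in G$, $g\in G'$; $B(G)\otimes\Bbbk$ carries the induced $\Bbbk G_{\mathrm{ab}}$-module structure. The action is trivial if every element of $G_{\mathrm{ab}}$ acts as the identity. $\mathrm{gr}^3_\Gamma(G)=\Gamma^3(G)/\Gamma^4(G)$, where $\Gamma^1(G)=G$, $\Gamma^{s+1}(G)=(\Gamma^s(G),G)$ is the lower central series. Tensor products are over $\mathbb{Z}$. *)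

theory Defs
  imports "HOL-Algebra.Algebra"
begin

definition finitely_generated_group :: "('a, 'b) monoid_scheme \<Rightarrow> bool" where
  "finitely_generated_group G \<longleftrightarrow>
     group G \<and> (\<exists>S. finite S \<and> S \<subseteq> carrier G \<and> generate G S = carrier G)"

definition field_characteristic_zero :: "('k, 'm) ring_scheme \<Rightarrow> bool" where
  "field_characteristic_zero K \<longleftrightarrow>
     field K \<and> (\<forall>n::nat. n > 0 \<longrightarrow> [n] \<cdot>\<^bsub>K\<^esub> \<one>\<^bsub>K\<^esub> \<noteq> \<zero>\<^bsub>K\<^esub>)"


section \<open>Lower central series\<close>

text \<open>The subgroup generated by the commutators $xyx^{-1}y^{-1}$, the convention of
  \<^const>\<open>derived\<close>.\<close>

definition commutator_subgroup :: "('a, 'b) monoid_scheme \<Rightarrow> 'a set \<Rightarrow> 'a set \<Rightarrow> 'a set" where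
  "commutator_subgroup G H K =
     generate G (\<Union>x\<in>H. \<Union>y\<in>K. {x \<otimes>\<^bsub>G\<^esub> y \<otimes>\<^bsub>G\<^esub> inv\<^bsub>G\<^esub> x \<otimes>\<^bsub>G\<^esub> inv\<^bsub>G\<^esub> y})"

text \<open>Indexed from 1; the value at 0 is a dummy.\<close>

fun lower_central_series :: "('a, 'b) monoid_scheme \<Rightarrow> nat \<Rightarrow> 'a set" where
  "lower_central_series G 0 = carrier G"
| "lower_central_series G (Suc 0) = carrier G"
| "lower_central_series G (Suc (Suc s)) =
     commutator_subgroup G (lower_central_series G (Suc s)) (carrier G)"

definition gr :: "nat \<Rightarrow> ('a, 'b) monoid_scheme \<Rightarrow> 'a set monoid" where
  "gr s G = (G\<lparr>carrier := lower_central_series G s\<rparr>) Mod lower_central_series G (s + 1)"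


section \<open>The Alexander invariant\<close>

abbreviation derived1 :: "('a, 'b) monoid_scheme \<Rightarrow> 'a set" where
  "derived1 G \<equiv> derived G (carrier G)"

abbreviation derived2 :: "('a, 'b) monoid_scheme \<Rightarrow> 'a set" where
  "derived2 G \<equiv> derived G (derived1 G)"

definition abelianization :: "('a, 'b) monoid_scheme \<Rightarrow> 'a set monoid" where
  "abelianization G = G Mod derived1 G"

definition alexander_invariant :: "('a, 'b) monoid_scheme \<Rightarrow> 'a set monoid" where
  "alexander_invariant G = G\<lparr>carrier := derived1 G\<rparr> Mod derived2 G"

text \<open>Elements of $G_{ab}$ and $B(G)$ are cosets; conjugating all representatives of one by
  all representatives of the other gives exactly one coset of $G''$, namely that of
  $hgh^{-1}$ (lemma \<open>alexander_action_coset\<close>).\<close>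

definition alexander_action :: "('a, 'b) monoid_scheme \<Rightarrow> 'a set \<Rightarrow> 'a set \<Rightarrow> 'a set" where
  "alexander_action G U V = (\<Union>h\<in>U. \<Union>g\<in>V. {h \<otimes>\<^bsub>G\<^esub> g \<otimes>\<^bsub>G\<^esub> inv\<^bsub>G\<^esub> h})"


section \<open>Tensor products over the integers\<close>

text \<open>Both factors are abelian groups given as monoid records. Compatibility with integer
  scalars follows from biadditivity.\<close>

definition tensor_relators ::
  "('a, 'c) monoid_scheme \<Rightarrow> ('k, 'd) monoid_scheme \<Rightarrow> ('a \<times> 'k \<Rightarrow>\<^sub>0 int) set" where
  "tensor_relators A B =
     {frag_of (a \<otimes>\<^bsub>A\<^esub> a', b) - frag_of (a, b) - frag_of (a', b) | a a' b.
        a \<in> carrier A \<and> a' \<in> carrier A \<and> b \<in> carrier B} \<union>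
     {frag_of (a, b \<otimes>\<^bsub>B\<^esub> b') - frag_of (a, b) - frag_of (a, b') | a b b'.
        a \<in> carrier A \<and> b \<in> carrier B \<and> b' \<in> carrier B}"

definition tensor_relations ::
  "('a, 'c) monoid_scheme \<Rightarrow> ('k, 'd) monoid_scheme \<Rightarrow> ('a \<times> 'k \<Rightarrow>\<^sub>0 int) set" where
  "tensor_relations A B =
     generate (free_Abelian_group (carrier A \<times> carrier B)) (tensor_relators A B)"

definition tensor ::
  "('a, 'c) monoid_scheme \<Rightarrow> ('k, 'd) monoid_scheme \<Rightarrow> ('a \<times> 'k \<Rightarrow>\<^sub>0 int) set monoid" where
  "tensor A B = free_Abelian_group (carrier A \<times> carrier B) Mod tensor_relations A B"

definition pure_tensor ::
  "('a, 'c) monoid_scheme \<Rightarrow> ('k, 'd) monoid_scheme \<Rightarrow> 'a \<Rightarrow> 'k \<Rightarrow> ('a \<times> 'k \<Rightarrow>\<^sub>0 int) set" where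
  "pure_tensor A B a b =
     tensor_relations A B #>\<^bsub>free_Abelian_group (carrier A \<times> carrier B)\<^esub> frag_of (a, b)"

text \<open>The map $f \otimes \mathrm{id}_B : A \otimes B \to A' \otimes B$ induced by a
  homomorphism $f : A \to A'$: on a coset \<open>C\<close>, the image of \<open>C\<close> in the free group, saturated by
  the relations of the target.\<close>

definition tensor_map ::
  "('a, 'c) monoid_scheme \<Rightarrow> ('e, 'f) monoid_scheme \<Rightarrow> ('k, 'd) monoid_scheme \<Rightarrow> ('a \<Rightarrow> 'e) \<Rightarrow>
   ('a \<times> 'k \<Rightarrow>\<^sub>0 int) set \<Rightarrow> ('e \<times> 'k \<Rightarrow>\<^sub>0 int) set" where
  "tensor_map A A' B f C =
     tensor_relations A' B <#>\<^bsub>free_Abelian_group (carrier A' \<times> carrier B)\<^esub>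
       (frag_extend (\<lambda>(a, b). frag_of (f a, b)) ` C)"


section \<open>The Alexander invariant over a field\<close>

definition alexander_invariant_over ::
  "('k, 'm) ring_scheme \<Rightarrow> ('a, 'b) monoid_scheme \<Rightarrow> ('a set \<times> 'k \<Rightarrow>\<^sub>0 int) set monoid" where
  "alexander_invariant_over K G = tensor (alexander_invariant G) (add_monoid K)"

definition alexander_action_over ::
  "('k, 'm) ring_scheme \<Rightarrow> ('a, 'b) monoid_scheme \<Rightarrow> 'a set \<Rightarrow>
   ('a set \<times> 'k \<Rightarrow>\<^sub>0 int) set \<Rightarrow> ('a set \<times> 'k \<Rightarrow>\<^sub>0 int) set" where
  "alexander_action_over K G U =
     tensor_map (alexander_invariant G) (alexander_invariant G) (add_monoid K)
       (alexander_action G U)"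

definition trivial_alexander_action_over ::
  "('k, 'm) ring_scheme \<Rightarrow> ('a, 'b) monoid_scheme \<Rightarrow> bool" where
  "trivial_alexander_action_over K G \<longleftrightarrow>
     (\<forall>U\<in>carrier (abelianization G). \<forall>t\<in>carrier (alexander_invariant_over K G).
        alexander_action_over K G U t = t)"


section \<open>Well-definedness\<close>

lemma (in group) derived2_conj:
  assumes "h \<in> carrier G" "z \<in> derived2 G"
  shows "h \<otimes> z \<otimes> inv h \<in> derived2 G"
proof -
  have "derived2 G \<lhd> G"
    using derived_is_normal[OF derived_self_is_normal] .
  then show ?thesis
    using assms by (simp add: normal.inv_op_closed2)
qed

lemma (in group) alexander_action_coset:
  assumes h: "h \<in> carrier G" and g: "g \<in> derived1 G"
  shows "alexander_action G (derived1 G #> h) (derived2 G #> g) = derived2 G #> (h \<otimes> g \<otimes> inv h)"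
proof -
  interpret D1: normal "derived1 G" G by (rule derived_self_is_normal)
  interpret D2: normal "derived2 G" G by (rule derived_is_normal[OF derived_self_is_normal])
  have sub: "derived2 G \<subseteq> derived1 G"
    using derived_incl[OF _ D1.subgroup_axioms] by blast
  have gG: "g \<in> carrier G" using g D1.subset by blast
  have "(c \<otimes> h) \<otimes> (z \<otimes> g) \<otimes> inv (c \<otimes> h) \<in> derived2 G #> (h \<otimes> g \<otimes> inv h)"
    if c: "c \<in> derived1 G" and z: "z \<in> derived2 G" for c z
  proof -
    let ?w = "h \<otimes> g \<otimes> inv h"
    have cG: "c \<in> carrier G" and zG: "z \<in> carrier G" using c z D1.subset D2.subset by auto
    have wG: "?w \<in> carrier G" using h gG by simp
    have w: "?w \<in> derived1 G" using D1.inv_op_closed2[OF h g] .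
    have comm: "c \<otimes> ?w \<otimes> inv c \<otimes> inv ?w \<in> derived2 G"
      unfolding derived_def[of G "derived1 G"]
      using c w by (intro generate.incl) blast
    have zc: "(c \<otimes> h) \<otimes> z \<otimes> inv (c \<otimes> h) \<in> derived2 G"
      using D2.inv_op_closed2[of "c \<otimes> h" z] cG h z by simp
    have "(c \<otimes> h) \<otimes> (z \<otimes> g) \<otimes> inv (c \<otimes> h) =
      ((c \<otimes> h) \<otimes> z \<otimes> inv (c \<otimes> h)) \<otimes> (c \<otimes> ?w \<otimes> inv c \<otimes> inv ?w) \<otimes> ?w"
      using cG h zG gG by (simp add: m_assoc inv_mult_group inv_solve_left' l_inv_ex)
        (simp add: m_assoc[symmetric])
    then show ?thesis
      using D2.m_closed[OF zc comm] by (auto simp: r_coset_def)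
  qed
  moreover have "z \<otimes> (h \<otimes> g \<otimes> inv h) \<in> alexander_action G (derived1 G #> h) (derived2 G #> g)"
    if z: "z \<in> derived2 G" for z
  proof -
    have zG: "z \<in> carrier G" using z D2.subset by auto
    have z': "inv h \<otimes> z \<otimes> h \<in> derived2 G" using D2.inv_op_closed1[OF h z] .
    have "z \<otimes> (h \<otimes> g \<otimes> inv h) = h \<otimes> ((inv h \<otimes> z \<otimes> h) \<otimes> g) \<otimes> inv h"
      using zG h gG by (simp add: m_assoc[symmetric])
    moreover have "h \<in> derived1 G #> h" using rcos_self[OF h D1.subgroup_axioms] .
    ultimately show ?thesis
      using z' unfolding alexander_action_def r_coset_def by blast
  qed
  ultimately show ?thesis
    unfolding alexander_action_def r_coset_def by auto
qed

lemma tensor_relators_subset: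
  assumes "comm_group A" "comm_group B"
  shows "tensor_relators A B \<subseteq> carrier (free_Abelian_group (carrier A \<times> carrier B))"
proof -
  interpret A: comm_group A by fact
  interpret B: comm_group B by fact
  have *: "Poly_Mapping.keys (frag_of x - frag_of y - frag_of z) \<subseteq> {x, y, z}"
    for x y z :: "'a \<times> 'c"
    using keys_diff[of "frag_of x - frag_of y" "frag_of z"] keys_diff[of "frag_of x" "frag_of y"]
    by auto
  show ?thesis
    unfolding tensor_relators_def free_Abelian_group_def by (auto dest!: subsetD[OF *])
qed

lemma subgroup_tensor_relations:
  assumes "comm_group A" "comm_group B"
  shows "subgroup (tensor_relations A B) (free_Abelian_group (carrier A \<times> carrier B))"
  unfolding tensor_relations_def
  by (intro group.generate_is_subgroup tensor_relators_subset assms) simp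

lemma tensor_map_coset:
  assumes A: "comm_group A" and A': "comm_group A'" and B: "comm_group B"
    and f: "f \<in> hom A A'"
    and c: "c \<in> carrier (free_Abelian_group (carrier A \<times> carrier B))"
  shows "tensor_map A A' B f (tensor_relations A B #>\<^bsub>free_Abelian_group (carrier A \<times> carrier B)\<^esub> c) =
    tensor_relations A' B #>\<^bsub>free_Abelian_group (carrier A' \<times> carrier B)\<^esub>
      frag_extend (\<lambda>(a, b). frag_of (f a, b)) c"
proof -
  let ?F = "free_Abelian_group (carrier A \<times> carrier B)"
  let ?F' = "free_Abelian_group (carrier A' \<times> carrier B)"
  let ?R = "tensor_relations A B" and ?R' = "tensor_relations A' B"
  let ?p = "frag_extend (\<lambda>(a, b). frag_of (f a, b))"
  interpret R': subgroup ?R' ?F' by (rule subgroup_tensor_relations[OF A' B])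
  interpret R: subgroup ?R ?F by (rule subgroup_tensor_relations[OF A B])
  have gen: "tensor_relators A' B \<subseteq> ?R'"
    unfolding tensor_relations_def by (auto intro: generate.incl)
  have p_rel: "?p r \<in> ?R'" if "r \<in> tensor_relators A B" for r
  proof -
    have "?p r \<in> tensor_relators A' B"
      using that f unfolding tensor_relators_def
      by (auto simp: frag_extend_diff hom_mult hom_in_carrier; blast intro: hom_in_carrier[OF f])
    then show ?thesis using gen by blast
  qed
  have neg: "- x \<in> ?R'" if "x \<in> ?R'" for x
  proof -
    have "x \<in> carrier ?F'" using that R'.subset by blast
    then have "inv\<^bsub>?F'\<^esub> x = - x" by (simp add: inv_free_Abelian_group)
    with R'.m_inv_closed[OF that] show ?thesis by simp
  qed
  have plus: "x + y \<in> ?R'" if "x \<in> ?R'" "y \<in> ?R'" for x y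
    using R'.m_closed[OF that] by simp
  have zero: "0 \<in> ?R'" using R'.one_closed by simp
  have p_R: "?p r \<in> ?R'" if "r \<in> ?R" for r
    using that unfolding tensor_relations_def[of A B]
  proof (induction rule: generate.induct)
    case one
    then show ?case using zero by simp
  next
    case (incl h)
    then show ?case by (rule p_rel)
  next
    case (inv h)
    then have "h \<in> carrier ?F" using tensor_relators_subset[OF A B] by blast
    then have "inv\<^bsub>?F\<^esub> h = - h" by (simp add: inv_free_Abelian_group)
    then show ?case using neg[OF p_rel[OF inv]] by (simp add: frag_extend_minus)
  next
    case (eng h1 h2)
    then show ?case using plus by (simp add: frag_extend_add)
  qed
  have "r' + ?p (r + c) \<in> (\<Union>s\<in>?R'. {s + ?p c})" if "r' \<in> ?R'" "r \<in> ?R" for r r'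
    using plus[OF that(1) p_R[OF that(2)]] by (auto simp: frag_extend_add add.assoc)
  moreover have "r' + ?p c \<in> (\<Union>s\<in>?R'. \<Union>r\<in>?R. {s + ?p (r + c)})" if "r' \<in> ?R'" for r'
    using that R.one_closed by force
  ultimately show ?thesis
    unfolding tensor_map_def set_mult_def r_coset_def by auto
qed

lemma tensor_map_pure:
  assumes "comm_group A" "comm_group A'" "comm_group B" "f \<in> hom A A'"
    and "a \<in> carrier A" "b \<in> carrier B"
  shows "tensor_map A A' B f (pure_tensor A B a b) = pure_tensor A' B (f a) b"
  using assms unfolding pure_tensor_def
  by (subst tensor_map_coset) (auto simp: free_Abelian_group_def)

end

theory Submission
  imports Defs
begin

text \<open>Triviality of the action says that for \<open>g \<in> G'\<close> and \<open>h \<in> G\<close> the class \<open>c\<close> of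
  \<open>(g, h)\<close> in \<open>B(G)\<close> satisfies \<open>c \<otimes> 1 = 0\<close> in \<open>B(G) \<otimes> K\<close>. Since \<open>(K, +)\<close> is uniquely
  divisible, this forces \<open>c\<close> to be torsion: a non-torsion element would be sent to 1 by some additive
  map \<open>B(G) \<rightarrow> K\<close>. As \<open>G'' \<subseteq> \<Gamma>\<^sup>4\<close>, the commutators \<open>(g, h)\<close> are torsion in
  \<open>gr\<^sup>3\<close> too. They generate this abelian group, so it is torsion and its tensor product with the
  divisible group \<open>K\<close> vanishes.\<close>

section \<open>Homomorphisms into uniquely divisible groups\<close>

text \<open>Written multiplicatively; an abelian group with this property is a vector space over the
  rationals.\<close>

definition uniquely_divisible :: "('a, 'b) monoid_scheme \<Rightarrow> bool" where
  "uniquely_divisible D \<longleftrightarrow>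
     (\<forall>n::nat. n > 0 \<longrightarrow> bij_betw (\<lambda>d. d [^]\<^bsub>D\<^esub> n) (carrier D) (carrier D))"

lemma uniquely_divisible_root:
  assumes "uniquely_divisible D" "n > 0" "d \<in> carrier D"
  obtains e where "e \<in> carrier D" "e [^]\<^bsub>D\<^esub> (n::nat) = d"
proof -
  have "(\<lambda>e. e [^]\<^bsub>D\<^esub> n) ` carrier D = carrier D"
    using assms(1,2) by (simp add: uniquely_divisible_def bij_betw_def)
  with \<open>d \<in> carrier D\<close> show thesis by (metis imageE that)
qed

lemma uniquely_divisible_inj:
  assumes "uniquely_divisible D" "n > 0" "d \<in> carrier D" "e \<in> carrier D"
    and "d [^]\<^bsub>D\<^esub> (n::nat) = e [^]\<^bsub>D\<^esub> n"
  shows "d = e"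
proof -
  have "inj_on (\<lambda>d. d [^]\<^bsub>D\<^esub> n) (carrier D)"
    using assms(1,2) by (simp add: uniquely_divisible_def bij_betw_def)
  from inj_onD[OF this assms(5,3,4)] show ?thesis .
qed

section \<open>Partial homomorphisms as subgroups of a direct product, and their extension\<close>

lemma DirProd_comm_group:
  assumes "comm_group A" "comm_group D"
  shows "comm_group (A \<times>\<times> D)"
proof -
  interpret A: comm_group A by fact
  interpret D: comm_group D by fact
  show ?thesis
    by (rule group.group_comm_groupI)
      (auto simp: DirProd_group A.is_group D.is_group A.m_comm D.m_comm)
qed

lemma int_pow_DirProd:
  assumes "group A" "group D" "x \<in> carrier A" "v \<in> carrier D"
  shows "(x, v) [^]\<^bsub>A \<times>\<times> D\<^esub> (n::int) = (x [^]\<^bsub>A\<^esub> n, v [^]\<^bsub>D\<^esub> n)"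
proof -
  interpret A: group A by fact
  interpret D: group D by fact
  interpret P: group "A \<times>\<times> D" by (rule DirProd_group) fact+
  have nat: "(x, v) [^]\<^bsub>A \<times>\<times> D\<^esub> (k::nat) = (x [^]\<^bsub>A\<^esub> k, v [^]\<^bsub>D\<^esub> k)" for k
    by (induction k) auto
  have xv: "(x, v) \<in> carrier (A \<times>\<times> D)" using assms by simp
  show ?thesis
  proof (cases n rule: int_cases2)
    case (nonneg k)
    then show ?thesis by (simp add: int_pow_int nat)
  next
    case (nonpos k)
    have "(x, v) [^]\<^bsub>A \<times>\<times> D\<^esub> n = inv\<^bsub>A \<times>\<times> D\<^esub> (x [^]\<^bsub>A\<^esub> k, v [^]\<^bsub>D\<^esub> k)"
      using nonpos P.int_pow_neg[OF xv, of "int k"] by (simp only: int_pow_int nat)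
    also have "\<dots> = (inv\<^bsub>A\<^esub> (x [^]\<^bsub>A\<^esub> k), inv\<^bsub>D\<^esub> (v [^]\<^bsub>D\<^esub> k))"
      using assms by (intro inv_DirProd A.nat_pow_closed D.nat_pow_closed)
    finally show ?thesis
      using nonpos assms(3,4) by (simp add: A.int_pow_neg D.int_pow_neg int_pow_int)
  qed
qed

text \<open>A homomorphism from a subgroup of \<open>A\<close> to \<open>D\<close>, encoded by its
  graph; the condition on the fibre over the identity makes it single-valued. Extension of
  homomorphisms becomes inclusion of sets, the form suited to Zorn's lemma.\<close>

definition partial_hom_graph ::
  "('a, 'c) monoid_scheme \<Rightarrow> ('d, 'e) monoid_scheme \<Rightarrow> ('a \<times> 'd) set \<Rightarrow> bool" where
  "partial_hom_graph A D M \<longleftrightarrow>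
     subgroup M (A \<times>\<times> D) \<and> (\<forall>w. (\<one>\<^bsub>A\<^esub>, w) \<in> M \<longrightarrow> w = \<one>\<^bsub>D\<^esub>)"

text \<open>The quotient of two points over \<open>x\<close> lies over the identity.\<close>

lemma partial_hom_graph_unique:
  assumes "group A" "group D" "partial_hom_graph A D M" "(x, v) \<in> M" "(x, w) \<in> M"
  shows "v = w"
proof -
  interpret A: group A by fact
  interpret D: group D by fact
  interpret M: subgroup M "A \<times>\<times> D" using assms(3) by (simp add: partial_hom_graph_def)
  have car: "x \<in> carrier A" "v \<in> carrier D" "w \<in> carrier D" using assms(4,5) M.subset by auto
  have "(x, v) \<otimes>\<^bsub>A \<times>\<times> D\<^esub> inv\<^bsub>A \<times>\<times> D\<^esub> (x, w) \<in> M"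
    by (intro M.m_closed M.m_inv_closed assms)
  then have "(\<one>\<^bsub>A\<^esub>, v \<otimes>\<^bsub>D\<^esub> inv\<^bsub>D\<^esub> w) \<in> M"
    using car assms(1,2) by simp
  then have "v \<otimes>\<^bsub>D\<^esub> inv\<^bsub>D\<^esub> w = \<one>\<^bsub>D\<^esub>" using assms(3) by (simp add: partial_hom_graph_def)
  then show ?thesis using car by (metis D.inv_closed D.inv_equality D.inv_inv)
qed

text \<open>The new graph is the product of \<open>M\<close> with the cyclic group generated by
  \<open>(x, v)\<close>. By \<open>compat\<close>, sending \<open>x\<close> to \<open>v\<close>
  agrees with \<open>M\<close> on every power of \<open>x\<close> in its domain, which keeps the
  fibre over the identity trivial.\<close>

lemma partial_hom_graph_adjoin:
  assumes "comm_group A" "comm_group D" "partial_hom_graph A D M"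
    and x: "x \<in> carrier A" and v: "v \<in> carrier D"
    and compat: "\<And>m w. (x [^]\<^bsub>A\<^esub> (m::int), w) \<in> M \<Longrightarrow> w = v [^]\<^bsub>D\<^esub> m"
  obtains M' where "partial_hom_graph A D M'" "M \<subseteq> M'" "(x, v) \<in> M'"
proof -
  interpret A: comm_group A by fact
  interpret D: comm_group D by fact
  interpret P: comm_group "A \<times>\<times> D" by (rule DirProd_comm_group) fact+
  interpret M: subgroup M "A \<times>\<times> D" using assms(3) by (simp add: partial_hom_graph_def)
  define Z where "Z = range (\<lambda>n::int. (x, v) [^]\<^bsub>A \<times>\<times> D\<^esub> n)"
  have xv: "(x, v) \<in> carrier (A \<times>\<times> D)" using x v by simp
  have pow: "(x, v) [^]\<^bsub>A \<times>\<times> D\<^esub> (n::int) = (x [^]\<^bsub>A\<^esub> n, v [^]\<^bsub>D\<^esub> n)" for n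
    using x v A.is_group D.is_group by (rule int_pow_DirProd[rotated 2])
  have Z: "subgroup Z (A \<times>\<times> D)" unfolding Z_def by (rule P.subgroup_of_powers[OF xv])
  let ?M' = "M <#>\<^bsub>A \<times>\<times> D\<^esub> Z"
  have sub: "subgroup ?M' (A \<times>\<times> D)" by (rule P.mult_subgroups[OF M.subgroup_axioms Z])
  have "w = \<one>\<^bsub>D\<^esub>" if "(\<one>\<^bsub>A\<^esub>, w) \<in> ?M'" for w
  proof -
    obtain y u n where yu: "(y, u) \<in> M" and
      eq: "\<one>\<^bsub>A\<^esub> = y \<otimes>\<^bsub>A\<^esub> x [^]\<^bsub>A\<^esub> (n::int)" "w = u \<otimes>\<^bsub>D\<^esub> v [^]\<^bsub>D\<^esub> n"
      using \<open>(\<one>\<^bsub>A\<^esub>, w) \<in> ?M'\<close> unfolding set_mult_def Z_def pow by auto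
    have car: "y \<in> carrier A" "u \<in> carrier D" using yu M.subset by auto
    \<comment> \<open>So \<open>y\<close> is a power of \<open>x\<close> in the domain of
      \<open>M\<close>, and \<open>compat\<close> determines its value \<open>u\<close>.\<close>
    have "y = x [^]\<^bsub>A\<^esub> (- n)"
      using eq(1) car x by (metis A.int_pow_closed A.int_pow_neg A.inv_equality A.inv_inv)
    then have "u = v [^]\<^bsub>D\<^esub> (- n)" using compat yu by blast
    then show ?thesis using eq(2) v by (simp add: D.int_pow_neg)
  qed
  then have "partial_hom_graph A D ?M'" using sub by (simp add: partial_hom_graph_def)
  moreover have mem: "p \<otimes>\<^bsub>A \<times>\<times> D\<^esub> q \<in> ?M'" if "p \<in> M" "q \<in> Z" for p q
    using that unfolding set_mult_def by blast
  moreover have "M \<subseteq> ?M'"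
  proof
    fix p assume "p \<in> M"
    have "p \<otimes>\<^bsub>A \<times>\<times> D\<^esub> \<one>\<^bsub>A \<times>\<times> D\<^esub> = p"
      using \<open>p \<in> M\<close> M.subset by (intro P.r_one) blast
    then show "p \<in> ?M'"
      using mem[OF \<open>p \<in> M\<close> subgroup.one_closed[OF Z]] by (simp only:)
  qed
  moreover have "(x, v) \<in> ?M'"
  proof -
    have "(x, v) \<in> Z" unfolding Z_def using P.int_pow_1[OF xv] by (metis rangeI)
    then show ?thesis using mem[OF M.one_closed] P.l_one[OF xv] by metis
  qed
  ultimately show thesis by (intro that)
qed

text \<open>If some \<open>x\<^sup>n\<close> with \<open>n > 0\<close> lies in the domain, \<open>v\<close> is the \<open>n\<close>-th root of its value; the
  choice of \<open>n\<close> is irrelevant because roots in \<open>D\<close> are unique.\<close>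

lemma partial_hom_graph_extend:
  assumes "comm_group A" "comm_group D" and div: "uniquely_divisible D"
    and M: "partial_hom_graph A D M" and x: "x \<in> carrier A"
  obtains M' v where "partial_hom_graph A D M'" "M \<subseteq> M'" "(x, v) \<in> M'"
proof -
  interpret A: comm_group A by fact
  interpret D: comm_group D by fact
  interpret P: comm_group "A \<times>\<times> D" by (rule DirProd_comm_group) fact+
  interpret M: subgroup M "A \<times>\<times> D" using M by (simp add: partial_hom_graph_def)
  have pow: "(y [^]\<^bsub>A\<^esub> (n::int), w [^]\<^bsub>D\<^esub> n) \<in> M" if "(y, w) \<in> M" for y w n
  proof -
    have "y \<in> carrier A" "w \<in> carrier D" using that M.subset by auto
    then show ?thesis
      using P.subgroup_int_pow_closed[OF M.subgroup_axioms that, of n]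
      by (simp add: int_pow_DirProd A.is_group D.is_group)
  qed
  have "\<exists>v\<in>carrier D. \<forall>m w. (x [^]\<^bsub>A\<^esub> (m::int), w) \<in> M \<longrightarrow> w = v [^]\<^bsub>D\<^esub> m"
  proof (cases "\<exists>n::nat. n > 0 \<and> (\<exists>w. (x [^]\<^bsub>A\<^esub> int n, w) \<in> M)")
    case True
    then obtain n w0 where n: "n > 0" and w0: "(x [^]\<^bsub>A\<^esub> int n, w0) \<in> M" by blast
    have w0D: "w0 \<in> carrier D" using w0 M.subset by auto
    obtain v where v: "v \<in> carrier D" "v [^]\<^bsub>D\<^esub> n = w0"
      using uniquely_divisible_root[OF div n w0D] by blast
    have "w = v [^]\<^bsub>D\<^esub> m" if w: "(x [^]\<^bsub>A\<^esub> m, w) \<in> M" for m :: int and w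
    proof -
      have wD: "w \<in> carrier D" using w M.subset by auto
      \<comment> \<open>The value at the power of \<open>x\<close> with exponent
        \<open>m * n\<close> is computed once from \<open>w\<close> and once from \<open>w0\<close>;
        uniqueness of \<open>n\<close>-th roots then identifies \<open>w\<close>.\<close>
      have "(x [^]\<^bsub>A\<^esub> (m * int n), w [^]\<^bsub>D\<^esub> int n) \<in> M"
        using pow[OF w, of "int n"] x by (simp add: A.int_pow_pow)
      moreover have "(x [^]\<^bsub>A\<^esub> (m * int n), w0 [^]\<^bsub>D\<^esub> m) \<in> M"
        using pow[OF w0, of m] x by (simp add: A.int_pow_pow mult.commute)
      ultimately have "w [^]\<^bsub>D\<^esub> int n = w0 [^]\<^bsub>D\<^esub> m"
        using partial_hom_graph_unique[OF A.is_group D.is_group M] by blast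
      also have "w0 = v [^]\<^bsub>D\<^esub> int n" using v by (simp add: int_pow_int)
      also have "\<dots> [^]\<^bsub>D\<^esub> m = (v [^]\<^bsub>D\<^esub> m) [^]\<^bsub>D\<^esub> int n"
        using v by (simp add: D.int_pow_pow mult.commute)
      finally show ?thesis
        using uniquely_divisible_inj[OF div n wD, of "v [^]\<^bsub>D\<^esub> m"] v by (simp add: int_pow_int)
    qed
    then show ?thesis using v by blast
  next
    case False
    \<comment> \<open>No positive power of \<open>x\<close> lies in the domain, so the identity can
      serve as the value at \<open>x\<close>.\<close>
    have "w = \<one>\<^bsub>D\<^esub> [^]\<^bsub>D\<^esub> m" if w: "(x [^]\<^bsub>A\<^esub> m, w) \<in> M" for m :: int and w
    proof -
      have "m = 0"
      proof (rule ccontr)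
        assume "m \<noteq> 0"
        \<comment> \<open>The exponent \<open>m * m\<close> is positive whatever the sign of
          \<open>m\<close>, which contradicts the case assumption.\<close>
        moreover have "(x [^]\<^bsub>A\<^esub> (m * m), w [^]\<^bsub>D\<^esub> m) \<in> M"
          using pow[OF w, of m] x by (simp add: A.int_pow_pow)
        moreover have "m * m = int (nat (m * m))" by simp
        ultimately show False using False by (metis of_nat_0_less_iff not_square_less_zero linorder_neqE mult_eq_0_iff)
      qed
      then show ?thesis using w M x by (simp add: partial_hom_graph_def)
    qed
    then show ?thesis by blast
  qed
  then obtain v where v: "v \<in> carrier D"
    and compat: "\<And>m w. (x [^]\<^bsub>A\<^esub> (m::int), w) \<in> M \<Longrightarrow> w = v [^]\<^bsub>D\<^esub> m"
    by blast
  show thesis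
    by (rule partial_hom_graph_adjoin[OF assms(1,2) M x v compat]) (auto intro: that)
qed

text \<open>Closure under the group operations involves at most two elements, and some member of the
  chain contains both; \<open>ne\<close> supplies the identity.\<close>

lemma partial_hom_graph_Union:
  assumes ch: "subset.chain {M. partial_hom_graph A D M} C" and ne: "C \<noteq> {}"
  shows "partial_hom_graph A D (\<Union>C)"
proof -
  have C: "subgroup M (A \<times>\<times> D)" "\<And>w. (\<one>\<^bsub>A\<^esub>, w) \<in> M \<Longrightarrow> w = \<one>\<^bsub>D\<^esub>" if "M \<in> C" for M
    using ch that by (auto simp: subset.chain_def partial_hom_graph_def)
  have lin: "M \<subseteq> N \<or> N \<subseteq> M" if "M \<in> C" "N \<in> C" for M N
    using ch that by (auto simp: subset.chain_def)
  have "subgroup (\<Union>C) (A \<times>\<times> D)"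
  proof (rule subgroup.intro)
    show "\<Union>C \<subseteq> carrier (A \<times>\<times> D)" using C(1) subgroup.subset by blast
    show "\<one>\<^bsub>A \<times>\<times> D\<^esub> \<in> \<Union>C" using C(1) ne subgroup.one_closed by blast
    show "inv\<^bsub>A \<times>\<times> D\<^esub> p \<in> \<Union>C" if "p \<in> \<Union>C" for p
    proof -
      from that obtain M where "M \<in> C" "p \<in> M" by blast
      then show ?thesis using subgroup.m_inv_closed[OF C(1)] by blast
    qed
    show "p \<otimes>\<^bsub>A \<times>\<times> D\<^esub> q \<in> \<Union>C" if pq: "p \<in> \<Union>C" "q \<in> \<Union>C" for p q
    proof -
      obtain M N where MN: "M \<in> C" "p \<in> M" "N \<in> C" "q \<in> N" using pq by blast
      from lin[OF MN(1,3)] obtain L where "L \<in> C" "p \<in> L" "q \<in> L" using MN by blast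
      then show ?thesis using subgroup.m_closed[OF C(1)] by blast
    qed
  qed
  then show ?thesis using C(2) unfolding partial_hom_graph_def by blast
qed

text \<open>Since \<open>a\<close> is not torsion, sending it to \<open>d\<close> is well defined on
  the cyclic group it generates. Zorn's lemma extends this map to all of \<open>A\<close>.\<close>

lemma exists_hom_to_uniquely_divisible:
  assumes "comm_group A" "comm_group D" and div: "uniquely_divisible D"
    and a: "a \<in> carrier A" and nontorsion: "\<And>n::nat. n > 0 \<Longrightarrow> a [^]\<^bsub>A\<^esub> n \<noteq> \<one>\<^bsub>A\<^esub>"
    and d: "d \<in> carrier D"
  obtains f where "f \<in> hom A D" "f a = d"
proof -
  interpret A: comm_group A by fact
  interpret D: comm_group D by fact
  interpret P: comm_group "A \<times>\<times> D" by (rule DirProd_comm_group) fact+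
  have triv: "partial_hom_graph A D {\<one>\<^bsub>A \<times>\<times> D\<^esub>}"
    unfolding partial_hom_graph_def using P.triv_subgroup by simp
  have compat: "w = d [^]\<^bsub>D\<^esub> m" if "(a [^]\<^bsub>A\<^esub> m, w) \<in> {\<one>\<^bsub>A \<times>\<times> D\<^esub>}" for m :: int and w
  proof -
    have "a [^]\<^bsub>A\<^esub> m = \<one>\<^bsub>A\<^esub>" "w = \<one>\<^bsub>D\<^esub>" using that by auto
    moreover have "m = 0"
    proof (cases m rule: int_cases3)
      case (pos n)
      then show ?thesis using nontorsion[of n] \<open>a [^]\<^bsub>A\<^esub> m = \<one>\<^bsub>A\<^esub>\<close> by (simp add: int_pow_int)
    next
      case (neg n)
      then show ?thesis
        using nontorsion[of n] \<open>a [^]\<^bsub>A\<^esub> m = \<one>\<^bsub>A\<^esub>\<close> a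
        by (simp add: A.int_pow_neg int_pow_int)
    qed
    ultimately show ?thesis by simp
  qed
  obtain M0 where M0: "partial_hom_graph A D M0" "(a, d) \<in> M0"
    using partial_hom_graph_adjoin[OF assms(1,2) triv a d compat] by metis
  \<comment> \<open>Only extensions of \<open>M0\<close> compete, so the maximal graph still sends
    \<open>a\<close> to \<open>d\<close>.\<close>
  define \<F> where "\<F> = {M. partial_hom_graph A D M \<and> M0 \<subseteq> M}"
  have "\<exists>M\<in>\<F>. \<forall>N\<in>\<F>. M \<subseteq> N \<longrightarrow> N = M"
  proof (rule subset_Zorn_nonempty)
    show "\<F> \<noteq> {}" using M0 by (auto simp: \<F>_def)
    fix C assume ne: "C \<noteq> {}" and ch: "subset.chain \<F> C"
    have "subset.chain {M. partial_hom_graph A D M} C"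
      using ch by (auto simp: subset.chain_def \<F>_def)
    moreover have "M0 \<subseteq> \<Union>C" using ne ch by (fastforce simp: subset.chain_def \<F>_def)
    ultimately show "\<Union>C \<in> \<F>" using partial_hom_graph_Union[OF _ ne] by (simp add: \<F>_def)
  qed
  then obtain M where M: "partial_hom_graph A D M" "M0 \<subseteq> M"
    and max: "\<And>N. partial_hom_graph A D N \<Longrightarrow> M \<subseteq> N \<Longrightarrow> N = M"
    unfolding \<F>_def by (smt (verit) mem_Collect_eq subset_trans)
  interpret M: subgroup M "A \<times>\<times> D" using M by (simp add: partial_hom_graph_def)
  \<comment> \<open>An element outside the domain would allow a proper extension, against
    maximality.\<close>
  have total: "\<exists>v. (x, v) \<in> M" if "x \<in> carrier A" for x
    using partial_hom_graph_extend[OF assms(1-3) M(1) that] max by metis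
  note uniq = partial_hom_graph_unique[OF A.is_group D.is_group M(1)]
  define f where "f x = (SOME v. (x, v) \<in> M)" for x
  have f: "(x, f x) \<in> M" if "x \<in> carrier A" for x
    unfolding f_def using total[OF that] by (rule someI_ex)
  have "f \<in> hom A D"
  proof (rule homI)
    fix x y assume xy: "x \<in> carrier A" "y \<in> carrier A"
    show "f x \<in> carrier D" using f[OF xy(1)] M.subset by auto
    have "(x \<otimes>\<^bsub>A\<^esub> y, f x \<otimes>\<^bsub>D\<^esub> f y) \<in> M"
      using M.m_closed[OF f[OF xy(1)] f[OF xy(2)]] by simp
    then show "f (x \<otimes>\<^bsub>A\<^esub> y) = f x \<otimes>\<^bsub>D\<^esub> f y"
      using f[of "x \<otimes>\<^bsub>A\<^esub> y"] xy uniq by blast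
  qed
  moreover have "f a = d" using uniq f[OF a] M0(2) M(2) by blast
  ultimately show thesis by (rule that)
qed

section \<open>Torsion and tensor products\<close>

lemma tensor_relations_closed:
  assumes "comm_group A" "comm_group B"
  shows "0 \<in> tensor_relations A B"
    and "\<lbrakk>x \<in> tensor_relations A B; y \<in> tensor_relations A B\<rbrakk> \<Longrightarrow>
      x + y \<in> tensor_relations A B"
    and "x \<in> tensor_relations A B \<Longrightarrow> - x \<in> tensor_relations A B"
    and "\<lbrakk>x \<in> tensor_relations A B; y \<in> tensor_relations A B\<rbrakk> \<Longrightarrow>
      x - y \<in> tensor_relations A B"
proof -
  interpret R: subgroup "tensor_relations A B" "free_Abelian_group (carrier A \<times> carrier B)"
    by (rule subgroup_tensor_relations) fact+
  show "0 \<in> tensor_relations A B" using R.one_closed by simp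
  show add: "x + y \<in> tensor_relations A B"
    if "x \<in> tensor_relations A B" "y \<in> tensor_relations A B" for x y
    using R.m_closed[OF that] by simp
  show uminus: "- x \<in> tensor_relations A B" if "x \<in> tensor_relations A B" for x
    using R.m_inv_closed[OF that] subsetD[OF R.subset that] by simp
  show "x - y \<in> tensor_relations A B"
    if "x \<in> tensor_relations A B" "y \<in> tensor_relations A B"
    using add[OF that(1) uminus[OF that(2)]] by simp
qed

text \<open>The universal property in the form needed to separate pure tensors: the extension
  \<open>h\<close> of \<open>\<beta>\<close> to the free abelian group kills the relators, hence is
  constant on cosets of the relations.\<close>

lemma biadditive_factors_through_tensor:
  assumes "comm_group A" "comm_group B" "comm_group C"
    and closed: "\<And>a b. \<lbrakk>a \<in> carrier A; b \<in> carrier B\<rbrakk> \<Longrightarrow> \<beta> a b \<in> carrier C"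
    and left: "\<And>a a' b. \<lbrakk>a \<in> carrier A; a' \<in> carrier A; b \<in> carrier B\<rbrakk> \<Longrightarrow>
      \<beta> (a \<otimes>\<^bsub>A\<^esub> a') b = \<beta> a b \<otimes>\<^bsub>C\<^esub> \<beta> a' b"
    and right: "\<And>a b b'. \<lbrakk>a \<in> carrier A; b \<in> carrier B; b' \<in> carrier B\<rbrakk> \<Longrightarrow>
      \<beta> a (b \<otimes>\<^bsub>B\<^esub> b') = \<beta> a b \<otimes>\<^bsub>C\<^esub> \<beta> a b'"
    and a: "a \<in> carrier A" "a' \<in> carrier A" and b: "b \<in> carrier B" "b' \<in> carrier B"
    and eq: "pure_tensor A B a b = pure_tensor A B a' b'"
  shows "\<beta> a b = \<beta> a' b'"
proof -
  interpret A: comm_group A by fact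
  interpret B: comm_group B by fact
  interpret C: comm_group C by fact
  let ?F = "free_Abelian_group (carrier A \<times> carrier B)"
  interpret F: comm_group ?F by (rule abelian_free_Abelian_group)
  obtain h where h: "h \<in> hom ?F C"
    and h_frag: "\<And>x. x \<in> carrier A \<times> carrier B \<Longrightarrow> h (frag_of x) = case_prod \<beta> x"
  proof (rule C.free_Abelian_group_universal)
    show "case_prod \<beta> ` (carrier A \<times> carrier B) \<subseteq> carrier C" using closed by auto
  qed blast
  interpret h: group_hom ?F C h
    using h by (simp add: group_hom_def group_hom_axioms_def C.is_group)
  have h_diff: "h (x - y) = h x \<otimes>\<^bsub>C\<^esub> inv\<^bsub>C\<^esub> h y"
    if "x \<in> carrier ?F" "y \<in> carrier ?F" for x y
    using h.hom_mult[OF that(1) F.inv_closed[OF that(2)]] h.hom_inv[OF that(2)] that by simp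
  have frag: "frag_of x - frag_of y \<in> carrier ?F"
    if "x \<in> carrier A \<times> carrier B" "y \<in> carrier A \<times> carrier B" for x y
    using F.m_closed[of "frag_of x" "inv\<^bsub>?F\<^esub> frag_of y"] F.inv_closed[of "frag_of y"] that
    by (simp del: carrier_free_Abelian_group_iff)
  have h_relator: "h (frag_of x - frag_of y - frag_of z) = \<one>\<^bsub>C\<^esub>"
    if "x \<in> carrier A \<times> carrier B" "y \<in> carrier A \<times> carrier B" "z \<in> carrier A \<times> carrier B"
      and "h (frag_of x) = h (frag_of y) \<otimes>\<^bsub>C\<^esub> h (frag_of z)" for x y z
  proof -
    have car: "frag_of x \<in> carrier ?F" "frag_of y \<in> carrier ?F" "frag_of z \<in> carrier ?F"
      using that by auto
    have "h (frag_of x - frag_of y - frag_of z) =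
        h (frag_of x) \<otimes>\<^bsub>C\<^esub> inv\<^bsub>C\<^esub> h (frag_of y) \<otimes>\<^bsub>C\<^esub> inv\<^bsub>C\<^esub> h (frag_of z)"
      using frag[OF that(1,2)] car by (simp only: h_diff)
    also have "\<dots> = \<one>\<^bsub>C\<^esub>"
      using h.hom_closed[OF car(2)] h.hom_closed[OF car(3)] that(4)
      by (simp add: C.m_assoc C.m_lcomm[of "h (frag_of z)"])
    finally show ?thesis .
  qed
  have relators: "tensor_relators A B \<subseteq> kernel ?F C h"
  proof
    fix r assume r: "r \<in> tensor_relators A B"
    then have "h r = \<one>\<^bsub>C\<^esub>"
      unfolding tensor_relators_def
      by (auto intro!: h_relator simp: h_frag left right)
    then show "r \<in> kernel ?F C h"
      using r tensor_relators_subset[OF assms(1,2)] unfolding kernel_def by blast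
  qed
  have relations: "tensor_relations A B \<subseteq> kernel ?F C h"
    unfolding tensor_relations_def
    by (rule F.generate_subgroup_incl[OF relators h.subgroup_kernel])
  \<comment> \<open>Each representative lies in its own coset; as the cosets agree, the two
    representatives differ by a relation \<open>r\<close>.\<close>
  have "frag_of (a, b) \<in> pure_tensor A B a' b'"
    unfolding eq[symmetric] unfolding pure_tensor_def
    using a b by (intro F.rcos_self subgroup_tensor_relations assms) auto
  then obtain r where r: "r \<in> tensor_relations A B" "frag_of (a, b) = r + frag_of (a', b')"
    unfolding pure_tensor_def r_coset_def by auto
  have "h (frag_of (a, b)) = h (r \<otimes>\<^bsub>?F\<^esub> frag_of (a', b'))" using r(2) by simp
  also have "\<dots> = h r \<otimes>\<^bsub>C\<^esub> h (frag_of (a', b'))"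
    using r(1) relations a b by (intro h.hom_mult) (auto simp: kernel_def)
  also have "h r = \<one>\<^bsub>C\<^esub>" using r(1) relations by (auto simp: kernel_def)
  finally show ?thesis using a b closed by (simp add: h_frag)
qed

text \<open>Taking the \<open>n\<close>-fold sum is multiplication by \<open>n\<close> times the
  unit of \<open>K\<close>, which is invertible in characteristic 0.\<close>

lemma field_characteristic_zero_uniquely_divisible:
  assumes "field_characteristic_zero K"
  shows "uniquely_divisible (add_monoid K)"
proof -
  interpret K: field K using assms by (simp add: field_characteristic_zero_def)
  have "bij_betw (\<lambda>d. [n] \<cdot>\<^bsub>K\<^esub> d) (carrier K) (carrier K)" if n: "n > 0" for n :: nat
  proof -
    let ?n = "[n] \<cdot>\<^bsub>K\<^esub> \<one>\<^bsub>K\<^esub>"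
    have "?n \<noteq> \<zero>\<^bsub>K\<^esub>" using assms n by (simp add: field_characteristic_zero_def)
    then have u: "?n \<in> Units K" using K.field_Units by simp
    have mult: "[n] \<cdot>\<^bsub>K\<^esub> d = ?n \<otimes>\<^bsub>K\<^esub> d" if "d \<in> carrier K" for d
      using K.add_pow_ldistr[of "\<one>\<^bsub>K\<^esub>" d n] that by simp
    have inv: "inv\<^bsub>K\<^esub> ?n \<otimes>\<^bsub>K\<^esub> (?n \<otimes>\<^bsub>K\<^esub> d) = d" "?n \<otimes>\<^bsub>K\<^esub> (inv\<^bsub>K\<^esub> ?n \<otimes>\<^bsub>K\<^esub> d) = d"
      if "d \<in> carrier K" for d
      using that u by (metis K.Units_closed K.Units_inv_closed K.Units_l_inv K.Units_r_inv K.l_one K.m_assoc)+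
    have closed: "inv\<^bsub>K\<^esub> ?n \<otimes>\<^bsub>K\<^esub> d \<in> carrier K" if "d \<in> carrier K" for d
      using that u by (intro K.m_closed K.Units_inv_closed)
    show ?thesis
    proof (rule bij_betw_byWitness[where f' = "\<lambda>d. inv\<^bsub>K\<^esub> ?n \<otimes>\<^bsub>K\<^esub> d"])
      show "\<forall>d\<in>carrier K. inv\<^bsub>K\<^esub> ?n \<otimes>\<^bsub>K\<^esub> ([n] \<cdot>\<^bsub>K\<^esub> d) = d" using inv(1) mult by metis
      show "\<forall>d\<in>carrier K. [n] \<cdot>\<^bsub>K\<^esub> (inv\<^bsub>K\<^esub> ?n \<otimes>\<^bsub>K\<^esub> d) = d" using inv(2) mult closed by metis
    qed (use closed in auto)
  qed
  then show ?thesis by (simp add: uniquely_divisible_def add_pow_def)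
qed

text \<open>A class that is non-torsion extends to an additive map \<open>f : A \<rightarrow> K\<close> with value 1 on it, and
  \<open>x \<otimes> k \<mapsto> f(x)k\<close> then separates the two pure tensors.\<close>

lemma torsion_if_pure_tensor_eq:
  assumes A: "comm_group A" and K: "field_characteristic_zero K"
    and a: "a \<in> carrier A" "a' \<in> carrier A"
    and eq: "pure_tensor A (add_monoid K) a \<one>\<^bsub>K\<^esub> = pure_tensor A (add_monoid K) a' \<one>\<^bsub>K\<^esub>"
  shows "\<exists>n::nat. n > 0 \<and> (a \<otimes>\<^bsub>A\<^esub> inv\<^bsub>A\<^esub> a') [^]\<^bsub>A\<^esub> n = \<one>\<^bsub>A\<^esub>"
proof (rule ccontr)
  assume nontorsion: "\<not> ?thesis"
  interpret A: comm_group A by fact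
  interpret K: field K using K by (simp add: field_characteristic_zero_def)
  let ?c = "a \<otimes>\<^bsub>A\<^esub> inv\<^bsub>A\<^esub> a'"
  have c: "?c \<in> carrier A" using a by simp
  have one: "\<one>\<^bsub>K\<^esub> \<in> carrier (add_monoid K)" by simp
  obtain f where f: "f \<in> hom A (add_monoid K)" and fc: "f ?c = \<one>\<^bsub>K\<^esub>"
    using exists_hom_to_uniquely_divisible[OF A K.a_comm_group
        field_characteristic_zero_uniquely_divisible[OF K] c _ one] nontorsion
    by metis
  have f_closed: "f x \<in> carrier K" if "x \<in> carrier A" for x
    using hom_in_carrier[OF f that] by simp
  have f_mult: "f (x \<otimes>\<^bsub>A\<^esub> y) = f x \<oplus>\<^bsub>K\<^esub> f y" if "x \<in> carrier A" "y \<in> carrier A" for x y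
    using hom_mult[OF f that] by simp
  have "f a \<otimes>\<^bsub>K\<^esub> \<one>\<^bsub>K\<^esub> = f a' \<otimes>\<^bsub>K\<^esub> \<one>\<^bsub>K\<^esub>"
    by (rule biadditive_factors_through_tensor[OF A K.a_comm_group K.a_comm_group _ _ _ a one one eq])
      (auto simp: f_closed f_mult K.l_distr K.r_distr)
  then have "f a = f a'" using a f_closed by simp
  \<comment> \<open>Additivity now gives \<open>f a = 1 + f a'\<close>, so that 1 = 0 in
    \<open>K\<close>.\<close>
  moreover have "?c \<otimes>\<^bsub>A\<^esub> a' = a" using a by (simp add: A.m_assoc)
  then have "f a = \<one>\<^bsub>K\<^esub> \<oplus>\<^bsub>K\<^esub> f a'" using f_mult[OF c a(2)] fc by simp
  ultimately have "\<one>\<^bsub>K\<^esub> = \<zero>\<^bsub>K\<^esub>" using f_closed[OF a(2)] K.add.l_cancel_one by auto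
  then show False using K.one_not_zero by simp
qed

text \<open>If \<open>n\<close> kills \<open>a\<close> and \<open>e\<close> is an
  \<open>n\<close>-th root of \<open>b\<close>, then moving the exponent \<open>n\<close> from
  \<open>e\<close> to \<open>a\<close> shows that \<open>a \<otimes> b\<close> vanishes. Thus the
  relations fill the free abelian group.\<close>

lemma torsion_tensor_divisible_trivial:
  assumes A: "comm_group A" and B: "comm_group B"
    and torsion: "\<And>a. a \<in> carrier A \<Longrightarrow> \<exists>n::nat. n > 0 \<and> a [^]\<^bsub>A\<^esub> n = \<one>\<^bsub>A\<^esub>"
    and div: "uniquely_divisible B"
  shows "carrier (tensor A B) = {\<one>\<^bsub>tensor A B\<^esub>}"
proof -
  interpret A: comm_group A by fact
  interpret B: comm_group B by fact
  let ?R = "tensor_relations A B"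
  let ?F = "free_Abelian_group (carrier A \<times> carrier B)"
  note closed = tensor_relations_closed[OF A B]
  have relators: "tensor_relators A B \<subseteq> ?R"
    unfolding tensor_relations_def by (auto intro: generate.incl)
  have left: "frag_of (a \<otimes>\<^bsub>A\<^esub> a', b) - frag_of (a, b) - frag_of (a', b) \<in> ?R"
    if "a \<in> carrier A" "a' \<in> carrier A" "b \<in> carrier B" for a a' b
    using that relators unfolding tensor_relators_def by blast
  have right: "frag_of (a, b \<otimes>\<^bsub>B\<^esub> b') - frag_of (a, b) - frag_of (a, b') \<in> ?R"
    if "a \<in> carrier A" "b \<in> carrier B" "b' \<in> carrier B" for a b b'
    using that relators unfolding tensor_relators_def by blast
  \<comment> \<open>The relator with both left entries equal to the identity is
    \<open>- frag_of (\<one>, b)\<close>.\<close>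
  have one_left: "frag_of (\<one>\<^bsub>A\<^esub>, b) \<in> ?R" if "b \<in> carrier B" for b
    using closed(3)[OF left[of "\<one>\<^bsub>A\<^esub>" "\<one>\<^bsub>A\<^esub>" b]] that by simp
  have one_right: "frag_of (a, \<one>\<^bsub>B\<^esub>) \<in> ?R" if "a \<in> carrier A" for a
    using closed(3)[OF right[of a "\<one>\<^bsub>B\<^esub>" "\<one>\<^bsub>B\<^esub>"]] that by simp
  have balanced: "frag_of (a [^]\<^bsub>A\<^esub> n, b) - frag_of (a, b [^]\<^bsub>B\<^esub> n) \<in> ?R"
    if "a \<in> carrier A" "b \<in> carrier B" for a b and n :: nat
  proof (induction n)
    case 0
    show ?case using closed(4)[OF one_left one_right] that by simp
  next
    case (Suc n)
    \<comment> \<open>A left relator minus a right relator plus the induction hypothesis; the terms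
      at exponent \<open>n\<close> and the two copies of \<open>frag_of (a, b)\<close>
      cancel.\<close>
    have "(frag_of (a [^]\<^bsub>A\<^esub> n \<otimes>\<^bsub>A\<^esub> a, b) - frag_of (a [^]\<^bsub>A\<^esub> n, b) - frag_of (a, b))
        - (frag_of (a, b [^]\<^bsub>B\<^esub> n \<otimes>\<^bsub>B\<^esub> b) - frag_of (a, b [^]\<^bsub>B\<^esub> n) - frag_of (a, b))
        + (frag_of (a [^]\<^bsub>A\<^esub> n, b) - frag_of (a, b [^]\<^bsub>B\<^esub> n)) \<in> ?R"
      using that by (intro closed(2)[OF closed(4) Suc] left right) auto
    then show ?case by (simp add: algebra_simps)
  qed
  have pure: "frag_of (a, b) \<in> ?R" if a: "a \<in> carrier A" and b: "b \<in> carrier B" for a b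
  proof -
    obtain n :: nat where n: "n > 0" "a [^]\<^bsub>A\<^esub> n = \<one>\<^bsub>A\<^esub>" using torsion[OF a] by blast
    obtain e where e: "e \<in> carrier B" "e [^]\<^bsub>B\<^esub> n = b"
      by (rule uniquely_divisible_root[OF div n(1) b])
    have "frag_of (\<one>\<^bsub>A\<^esub>, e) - (frag_of (a [^]\<^bsub>A\<^esub> n, e) - frag_of (a, e [^]\<^bsub>B\<^esub> n)) \<in> ?R"
      by (rule closed(4)[OF one_left[OF e(1)] balanced[OF a e(1)]])
    then show ?thesis using n(2) e(2) by simp
  qed
  have "x \<in> ?R" if "Poly_Mapping.keys x \<subseteq> carrier A \<times> carrier B" for x
    using that by (induction x rule: frag_induction) (auto intro: closed(1) closed(4) pure)
  then have "carrier ?F \<subseteq> ?R" by auto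
  then have R: "?R = carrier ?F" using subgroup.subset[OF subgroup_tensor_relations[OF A B]] by blast
  interpret F: group ?F by simp
  have "?R #>\<^bsub>?F\<^esub> x = ?R" if "x \<in> carrier ?F" for x
    unfolding R by (rule F.coset_join2[OF that F.subgroup_self that])
  moreover have "(0 :: ('a \<times> 'c) \<Rightarrow>\<^sub>0 int) \<in> carrier ?F" by simp
  ultimately show ?thesis unfolding tensor_def carrier_FactGroup by auto
qed

section \<open>The lower central series\<close>

lemma (in group) inv_mult_cancel:
  assumes "x \<in> carrier G" "y \<in> carrier G"
  shows "inv x \<otimes> (x \<otimes> y) = y" and "x \<otimes> (inv x \<otimes> y) = y"
  using assms by (simp_all add: m_assoc[symmetric])

text \<open>Conjugation is an automorphism preserving \<open>H\<close>, so it permutes the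
  generating commutators.\<close>

lemma (in group) commutator_subgroup_normal:
  assumes "H \<lhd> G"
  shows "commutator_subgroup G H (carrier G) \<lhd> G"
proof -
  interpret H: normal H G by fact
  show ?thesis
    unfolding commutator_subgroup_def
  proof (rule normal_generateI)
    show "(\<Union>x\<in>H. \<Union>y\<in>carrier G. {x \<otimes> y \<otimes> inv x \<otimes> inv y}) \<subseteq> carrier G"
      using H.subset by auto
    fix h g
    assume "h \<in> (\<Union>x\<in>H. \<Union>y\<in>carrier G. {x \<otimes> y \<otimes> inv x \<otimes> inv y})" and g: "g \<in> carrier G"
    then obtain x y where x: "x \<in> H" and y: "y \<in> carrier G"
      and h: "h = x \<otimes> y \<otimes> inv x \<otimes> inv y"
      by blast
    have xG: "x \<in> carrier G" using x H.subset by blast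
    let ?x = "g \<otimes> x \<otimes> inv g" and ?y = "g \<otimes> y \<otimes> inv g"
    have "g \<otimes> h \<otimes> inv g = ?x \<otimes> ?y \<otimes> inv ?x \<otimes> inv ?y"
      unfolding h using g xG y
      by (simp add: m_assoc inv_mult_group) (simp add: m_assoc[symmetric])
    then show "g \<otimes> h \<otimes> inv g \<in> (\<Union>x\<in>H. \<Union>y\<in>carrier G. {x \<otimes> y \<otimes> inv x \<otimes> inv y})"
      using H.inv_op_closed2[OF g x] g y by blast
  qed
qed

text \<open>A commutator is \<open>x\<close> times a conjugate of \<open>inv x\<close>.\<close>

lemma (in group) commutator_subgroup_subset:
  assumes "H \<lhd> G"
  shows "commutator_subgroup G H (carrier G) \<subseteq> H"
proof -
  interpret H: normal H G by fact
  have "x \<otimes> y \<otimes> inv x \<otimes> inv y \<in> H" if "x \<in> H" "y \<in> carrier G" for x y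
  proof -
    have "x \<otimes> (y \<otimes> inv x \<otimes> inv y) \<in> H"
      using that by (intro H.m_closed H.inv_op_closed2 H.m_inv_closed)
    then show ?thesis using that H.subset by (simp add: m_assoc subset_iff)
  qed
  then show ?thesis
    unfolding commutator_subgroup_def
    by (intro generate_subgroup_incl[OF _ H.subgroup_axioms]) blast
qed

lemma (in group) lower_central_series_normal: "lower_central_series G s \<lhd> G"
proof (induction s)
  case 0
  show ?case by (simp add: normal_imp_subgroup normal_inv_iff subgroup_self)
next
  case (Suc s)
  then show ?case
    \<comment> \<open>For \<open>s = 0\<close> the term at index 1 coincides with the dummy at index
      0; the recursion starts only afterwards.\<close>
    by (cases s) (simp_all add: commutator_subgroup_normal)
qed

lemma (in group) commutator_in_lower_central_series:
  assumes "x \<in> lower_central_series G (Suc s)" "y \<in> carrier G"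
  shows "x \<otimes> y \<otimes> inv x \<otimes> inv y \<in> lower_central_series G (Suc (Suc s))"
  using assms unfolding lower_central_series.simps(3) commutator_subgroup_def
  by (intro generate.incl) blast

lemma (in group) lower_central_series_2: "lower_central_series G 2 = derived1 G"
  by (simp add: numeral_2_eq_2 commutator_subgroup_def derived_def)

section \<open>The second derived subgroup lies in the fourth term of the lower central
  series\<close>

lemma (in group) commutes_with_mult:
  assumes "x \<in> carrier G" "a \<in> carrier G" "b \<in> carrier G" "x \<otimes> a = a \<otimes> x" "x \<otimes> b = b \<otimes> x"
  shows "x \<otimes> (a \<otimes> b) = (a \<otimes> b) \<otimes> x"
  using assms by (metis m_assoc)

text \<open>Conjugation by \<open>y\<close> multiplies \<open>u\<close> and \<open>v\<close> by central factors, which does not change their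
  commutator.\<close>

lemma (in group) commutes_with_commutator:
  assumes car: "y \<in> carrier G" "u \<in> carrier G" "v \<in> carrier G" "c \<in> carrier G" "d \<in> carrier G"
    and c: "y \<otimes> u = c \<otimes> u \<otimes> y" "\<And>g. g \<in> carrier G \<Longrightarrow> c \<otimes> g = g \<otimes> c"
    and d: "y \<otimes> v = d \<otimes> v \<otimes> y" "\<And>g. g \<in> carrier G \<Longrightarrow> d \<otimes> g = g \<otimes> d"
  shows "y \<otimes> (u \<otimes> v \<otimes> inv u \<otimes> inv v) = (u \<otimes> v \<otimes> inv u \<otimes> inv v) \<otimes> y"
proof -
  let ?w = "u \<otimes> v \<otimes> inv u \<otimes> inv v"
  \<comment> \<open>Both sides are compared after right multiplication by
    \<open>v \<otimes> u\<close>, which removes the inverses because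
    \<open>?w \<otimes> (v \<otimes> u) = u \<otimes> v\<close>.\<close>
  have "y \<otimes> ?w \<otimes> (v \<otimes> u) = y \<otimes> u \<otimes> v"
    using car by (simp add: m_assoc inv_mult_cancel)
  also have "\<dots> = c \<otimes> (u \<otimes> (y \<otimes> v))" using car c(1) by (simp add: m_assoc)
  also have "\<dots> = c \<otimes> (u \<otimes> d) \<otimes> (v \<otimes> y)" using car d(1) by (simp add: m_assoc)
  also have "u \<otimes> d = d \<otimes> u" using car d(2) by simp
  finally have l: "y \<otimes> ?w \<otimes> (v \<otimes> u) = c \<otimes> d \<otimes> (u \<otimes> v) \<otimes> y" using car by (simp add: m_assoc)
  have "?w \<otimes> y \<otimes> (v \<otimes> u) = ?w \<otimes> (y \<otimes> v) \<otimes> u" using car by (simp add: m_assoc)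
  also have "\<dots> = ?w \<otimes> d \<otimes> v \<otimes> (y \<otimes> u)" using car d(1) by (simp add: m_assoc)
  also have "\<dots> = ?w \<otimes> d \<otimes> (v \<otimes> c) \<otimes> u \<otimes> y" using car c(1) by (simp add: m_assoc)
  also have "v \<otimes> c = c \<otimes> v" using car c(2) by simp
  also have "?w \<otimes> d = d \<otimes> ?w" using car d(2) by simp
  also have "d \<otimes> ?w \<otimes> (c \<otimes> v) \<otimes> u \<otimes> y = d \<otimes> (?w \<otimes> c) \<otimes> (v \<otimes> u) \<otimes> y"
    using car by (simp add: m_assoc)
  also have "?w \<otimes> c = c \<otimes> ?w" using car c(2) by simp
  also have "d \<otimes> (c \<otimes> ?w) \<otimes> (v \<otimes> u) \<otimes> y = d \<otimes> c \<otimes> (?w \<otimes> (v \<otimes> u)) \<otimes> y"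
    using car by (simp add: m_assoc)
  also have "?w \<otimes> (v \<otimes> u) = u \<otimes> v" using car by (simp add: m_assoc inv_mult_cancel)
  also have "d \<otimes> c = c \<otimes> d" using car d(2) by simp
  finally have "y \<otimes> ?w \<otimes> (v \<otimes> u) = ?w \<otimes> y \<otimes> (v \<otimes> u)" using l by simp
  then show ?thesis using car by simp
qed

text \<open>Two elements have the same coset iff their quotient lies in \<open>H\<close>; the
  quotient of \<open>x \<otimes> y\<close> by \<open>y \<otimes> x\<close> is the
  commutator.\<close>

lemma (in normal) rcos_commute_iff:
  assumes "x \<in> carrier G" "y \<in> carrier G"
  shows "(H #> x) <#> (H #> y) = (H #> y) <#> (H #> x) \<longleftrightarrow> x \<otimes> y \<otimes> inv x \<otimes> inv y \<in> H"
proof -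
  have "H #> (x \<otimes> y) = H #> (y \<otimes> x) \<longleftrightarrow> x \<otimes> y \<otimes> inv (y \<otimes> x) \<in> H"
    using assms rcos_self[of "x \<otimes> y"] subgroup_axioms
    by (metis coset_join1 coset_join2 coset_mult_inv1 coset_mult_inv2 inv_closed m_closed subset)
  then show ?thesis using assms by (simp add: rcos_sum inv_mult_group m_assoc)
qed

text \<open>The case \<open>r = s = 2\<close> of \<open>(\<Gamma>\<^sup>r, \<Gamma>\<^sup>s) \<subseteq> \<Gamma>\<^sup>r\<^sup>+\<^sup>s\<close>.\<close>

lemma (in group) derived2_subset_lower_central_series: "derived2 G \<subseteq> lower_central_series G 4"
proof -
  let ?N = "lower_central_series G 4"
  interpret D: normal "derived1 G" G by (rule derived_self_is_normal)
  interpret N: normal ?N G by (rule lower_central_series_normal)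
  interpret Q: group "G Mod ?N" by (rule N.factorgroup_is_group)
  interpret \<pi>: group_hom G "G Mod ?N" "\<lambda>x. ?N #> x"
    using N.r_coset_hom_Mod by (simp add: group_hom_def group_hom_axioms_def)
  \<comment> \<open>These rules split cosets of products and work against \<open>N.rcos_sum\<close>,
    which merges them.\<close>
  note \<pi>.hom_mult [simp del] \<pi>.hom_inv [simp del]
  \<comment> \<open>By the definition of \<open>\<Gamma>\<^sup>4\<close>, the image of
    \<open>\<Gamma>\<^sup>3\<close> is central in the quotient.\<close>
  have central: "(?N #> c) \<otimes>\<^bsub>G Mod ?N\<^esub> Z = Z \<otimes>\<^bsub>G Mod ?N\<^esub> (?N #> c)"
    if c: "c \<in> lower_central_series G 3" and Z: "Z \<in> carrier (G Mod ?N)" for c Z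
  proof -
    obtain z where z: "z \<in> carrier G" "Z = ?N #> z" using Z unfolding carrier_FactGroup by blast
    have "c \<in> carrier G" using normal_imp_subgroup[OF lower_central_series_normal] c subgroup.subset by blast
    moreover have "c \<otimes> z \<otimes> inv c \<otimes> inv z \<in> ?N"
      using commutator_in_lower_central_series[of c 2 z] c z by (simp add: eval_nat_numeral)
    ultimately show ?thesis using z N.rcos_commute_iff by simp
  qed
  \<comment> \<open>For \<open>y\<close> in \<open>G'\<close> the commutators of \<open>y\<close>
    with \<open>u\<close> and with \<open>v\<close> lie in \<open>\<Gamma>\<^sup>3\<close>; they are
    the central factors that \<open>commutes_with_commutator\<close> asks for.\<close>
  have gen: "(?N #> y) \<otimes>\<^bsub>G Mod ?N\<^esub> (?N #> (u \<otimes> v \<otimes> inv u \<otimes> inv v)) =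
      (?N #> (u \<otimes> v \<otimes> inv u \<otimes> inv v)) \<otimes>\<^bsub>G Mod ?N\<^esub> (?N #> y)"
    if y: "y \<in> derived1 G" and uv: "u \<in> carrier G" "v \<in> carrier G" for y u v
  proof -
    have yG: "y \<in> carrier G" using y D.subset by blast
    have swap: "(?N #> y) \<otimes>\<^bsub>G Mod ?N\<^esub> (?N #> g) =
        (?N #> (y \<otimes> g \<otimes> inv y \<otimes> inv g)) \<otimes>\<^bsub>G Mod ?N\<^esub> (?N #> g) \<otimes>\<^bsub>G Mod ?N\<^esub> (?N #> y)"
      if "g \<in> carrier G" for g
      using that yG by (simp add: N.rcos_sum m_assoc)
    have G3: "y \<otimes> g \<otimes> inv y \<otimes> inv g \<in> lower_central_series G 3" if "g \<in> carrier G" for g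
      using commutator_in_lower_central_series[of y 1 g] y that lower_central_series_2
      by (simp add: eval_nat_numeral)
    have hom: "?N #> (u \<otimes> v \<otimes> inv u \<otimes> inv v) = (?N #> u) \<otimes>\<^bsub>G Mod ?N\<^esub> (?N #> v)
        \<otimes>\<^bsub>G Mod ?N\<^esub> inv\<^bsub>G Mod ?N\<^esub> (?N #> u) \<otimes>\<^bsub>G Mod ?N\<^esub> inv\<^bsub>G Mod ?N\<^esub> (?N #> v)"
      using uv by (simp only: \<pi>.hom_mult \<pi>.hom_inv m_closed inv_closed)
    show ?thesis
      unfolding hom
      by (rule Q.commutes_with_commutator[OF _ _ _ _ _ swap[OF uv(1)] central[OF G3[OF uv(1)]]
            swap[OF uv(2)] central[OF G3[OF uv(2)]]])
        (use yG uv in \<open>auto intro!: \<pi>.hom_closed simp del: mult_FactGroup\<close>)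
  qed
  have comm: "y \<otimes> x \<otimes> inv y \<otimes> inv x \<in> ?N" if y: "y \<in> derived1 G" and x: "x \<in> derived1 G" for x y
  proof -
    have yG: "y \<in> carrier G" using y D.subset by blast
    \<comment> \<open>The preimage of the centralizer of the coset of \<open>y\<close>: a subgroup
      containing the generators of \<open>G'\<close> by \<open>gen\<close>.\<close>
    let ?C = "{x \<in> carrier G. (?N #> y) \<otimes>\<^bsub>G Mod ?N\<^esub> (?N #> x) = (?N #> x) \<otimes>\<^bsub>G Mod ?N\<^esub> (?N #> y)}"
    have "subgroup ?C G"
    proof (rule subgroupI)
      show "?C \<subseteq> carrier G" by blast
      have "\<one> \<in> ?C" using yG N.rcos_commute_iff[OF yG one_closed] by simp
      then show "?C \<noteq> {}" by blast
      show "inv a \<in> ?C" if "a \<in> ?C" for a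
      proof -
        have a: "a \<in> carrier G" using that by blast
        \<comment> \<open>Conjugating the commutator of \<open>y\<close> and \<open>a\<close> by
          \<open>inv a\<close> and then inverting yields the commutator of \<open>y\<close> and
          \<open>inv a\<close>.\<close>
        have "inv a \<otimes> (y \<otimes> a \<otimes> inv y \<otimes> inv a) \<otimes> inv (inv a) \<in> ?N"
          using that yG a N.rcos_commute_iff[OF yG a] by (intro N.inv_op_closed2) auto
        then have "inv (inv a \<otimes> y \<otimes> a \<otimes> inv y) \<in> ?N"
          using yG a by (intro N.m_inv_closed) (simp add: m_assoc)
        then have "y \<otimes> inv a \<otimes> inv y \<otimes> inv (inv a) \<in> ?N"
          using yG a by (simp add: m_assoc inv_mult_group)
        then show ?thesis using a yG N.rcos_commute_iff[of y "inv a"] by simp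
      qed
      show "a \<otimes> b \<in> ?C" if ab: "a \<in> ?C" "b \<in> ?C" for a b
      proof -
        have car: "a \<in> carrier G" "b \<in> carrier G" using ab by auto
        note Qcar = \<pi>.hom_closed[OF yG] \<pi>.hom_closed[OF car(1)] \<pi>.hom_closed[OF car(2)]
        have "(?N #> y) \<otimes>\<^bsub>G Mod ?N\<^esub> ((?N #> a) \<otimes>\<^bsub>G Mod ?N\<^esub> (?N #> b)) =
            ((?N #> a) \<otimes>\<^bsub>G Mod ?N\<^esub> (?N #> b)) \<otimes>\<^bsub>G Mod ?N\<^esub> (?N #> y)"
          using ab by (intro Q.commutes_with_mult Qcar) blast+
        then show ?thesis using car by (simp add: N.rcos_sum)
      qed
    qed
    moreover have "(\<Union>u\<in>carrier G. \<Union>v\<in>carrier G. {u \<otimes> v \<otimes> inv u \<otimes> inv v}) \<subseteq> ?C"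
      using gen[OF y] by auto
    ultimately have "derived1 G \<subseteq> ?C" unfolding derived_def by (intro generate_subgroup_incl)
    then show ?thesis using x yG N.rcos_commute_iff[of y x] by auto
  qed
  then show ?thesis
    unfolding derived_def[of G "derived1 G"]
    by (intro generate_subgroup_incl[OF _ N.subgroup_axioms]) blast
qed

section \<open>The abelian group \<open>gr 3 G\<close>\<close>

lemma (in group) lower_central_series_antimono_3_4:
  "lower_central_series G 4 \<subseteq> lower_central_series G 3"
  using commutator_subgroup_subset[OF lower_central_series_normal[of 3]]
  by (simp add: eval_nat_numeral)

text \<open>The quotient is formed inside the restricted group, but cosets and their products use
  only the multiplication of \<open>G\<close>, so computations can take place in
  \<open>G\<close>.\<close>

lemma (in group) gr_3_simps:
  "carrier (gr 3 G) = (\<lambda>g. lower_central_series G 4 #> g) ` lower_central_series G 3"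
  "\<one>\<^bsub>gr 3 G\<^esub> = lower_central_series G 4"
  "U \<otimes>\<^bsub>gr 3 G\<^esub> V = U <#> V"
  by (auto simp: gr_def carrier_FactGroup r_coset_def set_mult_def)

text \<open>Commutators of \<open>\<Gamma>\<^sup>3\<close> with all of \<open>G\<close>, in
  particular with itself, lie in \<open>\<Gamma>\<^sup>4\<close>.\<close>

lemma (in group) gr_3_comm_group: "comm_group (gr 3 G)"
proof -
  let ?H = "lower_central_series G 3" and ?N = "lower_central_series G 4"
  interpret H: normal ?H G by (rule lower_central_series_normal)
  interpret N: normal ?N G by (rule lower_central_series_normal)
  interpret HN: normal ?N "G\<lparr>carrier := ?H\<rparr>"
    by (rule normal_restrict_supergroup[OF H.subgroup_axioms N.normal_axioms
          lower_central_series_antimono_3_4])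
  have "(?N #> x) <#> (?N #> y) = (?N #> y) <#> (?N #> x)" if "x \<in> ?H" "y \<in> ?H" for x y
    using commutator_in_lower_central_series[of x 2 y] that H.subset N.rcos_commute_iff[of x y]
    by (auto simp: eval_nat_numeral)
  moreover have "group (gr 3 G)" using HN.factorgroup_is_group by (simp add: gr_def)
  ultimately show ?thesis
    by (intro group.group_comm_groupI) (auto simp: gr_3_simps)
qed

section \<open>Torsion in the Alexander invariant\<close>

lemma (in group) alexander_invariant_comm_group: "comm_group (alexander_invariant G)"
  unfolding alexander_invariant_def
  by (intro derived_quot_of_subgroup_is_comm_group normal_imp_subgroup derived_self_is_normal)

lemma (in group) alexander_invariant_simps:
  "carrier (alexander_invariant G) = (\<lambda>g. derived2 G #> g) ` derived1 G"
  "U \<otimes>\<^bsub>alexander_invariant G\<^esub> V = U <#> V"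
  "\<one>\<^bsub>alexander_invariant G\<^esub> = derived2 G"
  by (auto simp: alexander_invariant_def carrier_FactGroup r_coset_def set_mult_def)

text \<open>Makes \<open>tensor_map_pure\<close> applicable to the action; conjugation by
  \<open>h\<close> is multiplicative.\<close>

lemma (in group) alexander_action_hom:
  assumes h: "h \<in> carrier G"
  shows "alexander_action G (derived1 G #> h) \<in> hom (alexander_invariant G) (alexander_invariant G)"
proof -
  interpret D1: normal "derived1 G" G by (rule derived_self_is_normal)
  interpret D2: normal "derived2 G" G by (rule derived_is_normal[OF derived_self_is_normal])
  have conj: "h \<otimes> g \<otimes> inv h \<in> derived1 G" if "g \<in> derived1 G" for g
    by (rule D1.inv_op_closed2[OF h that])
  have "derived2 G #> (h \<otimes> (a \<otimes> b) \<otimes> inv h) =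
      (derived2 G #> (h \<otimes> a \<otimes> inv h)) <#> (derived2 G #> (h \<otimes> b \<otimes> inv h))"
    if "a \<in> derived1 G" "b \<in> derived1 G" for a b
  proof -
    have "a \<in> carrier G" "b \<in> carrier G" using that D1.subset by auto
    moreover from this have "h \<otimes> (a \<otimes> b) \<otimes> inv h = (h \<otimes> a \<otimes> inv h) \<otimes> (h \<otimes> b \<otimes> inv h)"
      using h by (simp add: m_assoc inv_mult_cancel)
    ultimately show ?thesis using h by (simp add: D2.rcos_sum)
  qed
  moreover have "a \<in> carrier G" if "a \<in> derived1 G" for a using that D1.subset by blast
  ultimately show ?thesis
    by (intro homI)
      (auto simp: alexander_invariant_simps alexander_action_coset[OF h] D2.rcos_sum
        D1.m_closed conj)
qed

text \<open>Triviality is tested on the pure tensor of the class of \<open>g\<close> with 1. Torsion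
  in \<open>B(G)\<close> is phrased through powers in \<open>G\<close>, ready for transfer to
  another quotient.\<close>

lemma (in group) commutator_torsion_mod_derived2:
  assumes K: "field_characteristic_zero K" and triv: "trivial_alexander_action_over K G"
    and g: "g \<in> derived1 G" and h: "h \<in> carrier G"
  shows "\<exists>n::nat. n > 0 \<and> (g \<otimes> h \<otimes> inv g \<otimes> inv h) [^] n \<in> derived2 G"
proof -
  interpret K: field K using K by (simp add: field_characteristic_zero_def)
  interpret D1: normal "derived1 G" G by (rule derived_self_is_normal)
  interpret D2: normal "derived2 G" G by (rule derived_is_normal[OF derived_self_is_normal])
  let ?B = "alexander_invariant G" and ?K = "add_monoid K"
  interpret B: comm_group ?B by (rule alexander_invariant_comm_group)
  let ?V = "derived2 G #> g" and ?U = "derived1 G #> h"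
  let ?W = "derived2 G #> (h \<otimes> g \<otimes> inv h)"
  have gG: "g \<in> carrier G" using g D1.subset by blast
  have V: "?V \<in> carrier ?B" using g by (simp add: alexander_invariant_simps)
  have W: "?W \<in> carrier ?B"
    using D1.inv_op_closed2[OF h g] by (simp add: alexander_invariant_simps)
  have one: "\<one>\<^bsub>K\<^esub> \<in> carrier ?K" by simp
  have "pure_tensor ?B ?K ?V \<one>\<^bsub>K\<^esub> \<in> carrier (alexander_invariant_over K G)"
    unfolding alexander_invariant_over_def tensor_def pure_tensor_def carrier_FactGroup
    using V one by (intro imageI) simp
  moreover have "?U \<in> carrier (abelianization G)"
    using h by (simp add: abelianization_def carrier_FactGroup)
  ultimately have "alexander_action_over K G ?U (pure_tensor ?B ?K ?V \<one>\<^bsub>K\<^esub>) =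
      pure_tensor ?B ?K ?V \<one>\<^bsub>K\<^esub>"
    using triv by (simp add: trivial_alexander_action_over_def)
  \<comment> \<open>On the pure tensor, the action replaces \<open>g\<close> by its conjugate under
    \<open>h\<close>.\<close>
  then have "pure_tensor ?B ?K ?W \<one>\<^bsub>K\<^esub> = pure_tensor ?B ?K ?V \<one>\<^bsub>K\<^esub>"
    unfolding alexander_action_over_def
      tensor_map_pure[OF B.comm_group_axioms B.comm_group_axioms K.a_comm_group
        alexander_action_hom[OF h] V one]
      alexander_action_coset[OF h g] .
  then obtain n :: nat where n: "n > 0" "(?V \<otimes>\<^bsub>?B\<^esub> inv\<^bsub>?B\<^esub> ?W) [^]\<^bsub>?B\<^esub> n = \<one>\<^bsub>?B\<^esub>"
    using torsion_if_pure_tensor_eq[OF B.comm_group_axioms K V W] by metis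
  let ?c = "g \<otimes> h \<otimes> inv g \<otimes> inv h"
  have c: "?c \<in> carrier G" using gG h by simp
  have c1: "?c \<in> derived1 G"
    using D1.m_closed[OF g D1.inv_op_closed2[OF h D1.m_inv_closed[OF g]]] gG h by (simp add: m_assoc)
  \<comment> \<open>Since \<open>?c \<otimes> (h \<otimes> g \<otimes> inv h) = g\<close>, the
    torsion element just found is the class of \<open>?c\<close>.\<close>
  have "(derived2 G #> ?c) \<otimes>\<^bsub>?B\<^esub> ?W = ?V"
    using gG h c by (simp add: alexander_invariant_simps D2.rcos_sum m_assoc inv_mult_cancel)
  then have "?V \<otimes>\<^bsub>?B\<^esub> inv\<^bsub>?B\<^esub> ?W = derived2 G #> ?c"
    using W c1 by (metis B.inv_solve_right alexander_invariant_simps(1) V image_eqI)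
  moreover have "(derived2 G #> ?c) [^]\<^bsub>?B\<^esub> k = derived2 G #> (?c [^] k)" for k :: nat
  proof (induction k)
    case 0
    show ?case using D2.subset by (simp add: alexander_invariant_simps coset_mult_one)
  next
    case (Suc k)
    then show ?case using c by (simp add: alexander_invariant_simps D2.rcos_sum)
  qed
  ultimately have "derived2 G #> (?c [^] n) = derived2 G"
    using n(2) by (simp add: alexander_invariant_simps)
  then have "?c [^] n \<in> derived2 G"
    using rcos_self[OF nat_pow_closed[OF c, of n] D2.subgroup_axioms] by simp
  then show ?thesis using n(1) by blast
qed

section \<open>From torsion generators to a torsion group\<close>

lemma (in comm_group) torsion_subgroup:
  "subgroup {x \<in> carrier G. \<exists>n::nat. n > 0 \<and> x [^] n = \<one>} G"
proof (rule subgroupI)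
  show "{x \<in> carrier G. \<exists>n::nat. n > 0 \<and> x [^] n = \<one>} \<noteq> {}" by force
  show "inv a \<in> {x \<in> carrier G. \<exists>n::nat. n > 0 \<and> x [^] n = \<one>}"
    if "a \<in> {x \<in> carrier G. \<exists>n::nat. n > 0 \<and> x [^] n = \<one>}" for a
    using that by (auto simp: nat_pow_inv)
  show "a \<otimes> b \<in> {x \<in> carrier G. \<exists>n::nat. n > 0 \<and> x [^] n = \<one>}"
    if ab: "a \<in> {x \<in> carrier G. \<exists>n::nat. n > 0 \<and> x [^] n = \<one>}"
      "b \<in> {x \<in> carrier G. \<exists>n::nat. n > 0 \<and> x [^] n = \<one>}" for a b
  proof -
    obtain m n :: nat where mn: "m > 0" "a [^] m = \<one>" "n > 0" "b [^] n = \<one>" using ab by blast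
    have car: "a \<in> carrier G" "b \<in> carrier G" using ab by auto
    have "(a \<otimes> b) [^] (m * n) = (a [^] m) [^] n \<otimes> (b [^] n) [^] m"
      using car by (simp add: nat_pow_distrib nat_pow_pow mult.commute)
    then have "(a \<otimes> b) [^] (m * n) = \<one>" using mn by simp
    then show ?thesis using mn car by (auto intro!: exI[of _ "m * n"])
  qed
qed auto

text \<open>The preimage \<open>?P\<close> in \<open>\<Gamma>\<^sup>3\<close> of the torsion
  subgroup contains the commutators generating \<open>\<Gamma>\<^sup>3\<close>, so it is everything.
  Working with the preimage keeps generation inside \<open>G\<close>.\<close>

lemma (in group) gr_3_torsion:
  assumes K: "field_characteristic_zero K" and triv: "trivial_alexander_action_over K G"
    and W: "W \<in> carrier (gr 3 G)"
  shows "\<exists>n::nat. n > 0 \<and> W [^]\<^bsub>gr 3 G\<^esub> n = \<one>\<^bsub>gr 3 G\<^esub>"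
proof -
  let ?H = "lower_central_series G 3" and ?N = "lower_central_series G 4"
  define T where "T = {Y \<in> carrier (gr 3 G). \<exists>n::nat. n > 0 \<and> Y [^]\<^bsub>gr 3 G\<^esub> n = \<one>\<^bsub>gr 3 G\<^esub>}"
  interpret H: normal ?H G by (rule lower_central_series_normal)
  interpret N: normal ?N G by (rule lower_central_series_normal)
  interpret Q: comm_group "gr 3 G" by (rule gr_3_comm_group)
  interpret T: subgroup T "gr 3 G" unfolding T_def by (rule Q.torsion_subgroup)
  have pow: "(?N #> x) [^]\<^bsub>gr 3 G\<^esub> k = ?N #> (x [^] k)" if "x \<in> carrier G" for x and k :: nat
    using that N.subset by (induction k) (simp_all add: gr_3_simps N.rcos_sum coset_mult_one)
  let ?P = "{x \<in> ?H. ?N #> x \<in> T}"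
  have "subgroup ?P G"
  proof (rule subgroupI)
    show "?P \<subseteq> carrier G" using H.subset by blast
    have "\<one> \<in> ?P" using T.one_closed N.subset by (simp add: gr_3_simps coset_mult_one)
    then show "?P \<noteq> {}" by blast
    show "a \<otimes> b \<in> ?P" if "a \<in> ?P" "b \<in> ?P" for a b
      using that T.m_closed[of "?N #> a" "?N #> b"] H.subset H.m_closed
      by (auto simp: gr_3_simps N.rcos_sum subset_iff)
    show "inv a \<in> ?P" if a: "a \<in> ?P" for a
    proof -
      have aH: "a \<in> ?H" "a \<in> carrier G" using a H.subset by blast+
      have "(?N #> inv a) \<otimes>\<^bsub>gr 3 G\<^esub> (?N #> a) = \<one>\<^bsub>gr 3 G\<^esub>"
        using aH N.subset by (simp add: gr_3_simps N.rcos_sum coset_mult_one)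
      then have "inv\<^bsub>gr 3 G\<^esub> (?N #> a) = ?N #> inv a"
        using aH by (intro Q.inv_equality) (auto simp: gr_3_simps H.m_inv_closed)
      moreover have "inv\<^bsub>gr 3 G\<^esub> (?N #> a) \<in> T" using a by (intro T.m_inv_closed) blast
      ultimately show ?thesis using H.m_inv_closed[OF aH(1)] by simp
    qed
  qed
  moreover have "(\<Union>x\<in>derived1 G. \<Union>y\<in>carrier G. {x \<otimes> y \<otimes> inv x \<otimes> inv y}) \<subseteq> ?P"
  proof clarify
    fix g h assume gh: "g \<in> derived1 G" "h \<in> carrier G"
    let ?c = "g \<otimes> h \<otimes> inv g \<otimes> inv h"
    obtain n :: nat where n: "n > 0" "?c [^] n \<in> derived2 G"
      using commutator_torsion_mod_derived2[OF K triv gh] by blast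
    have c: "?c \<in> ?H"
      using commutator_in_lower_central_series[of g 1 h] gh lower_central_series_2
      by (simp add: eval_nat_numeral)
    then have cG: "?c \<in> carrier G" using H.subset by blast
    \<comment> \<open>Here the inclusion of \<open>G''\<close> in \<open>\<Gamma>\<^sup>4\<close>
      carries torsion from \<open>B(G)\<close> over to \<open>gr 3 G\<close>.\<close>
    have "?c [^] n \<in> ?N" using n(2) derived2_subset_lower_central_series by blast
    then have "(?N #> ?c) [^]\<^bsub>gr 3 G\<^esub> n = \<one>\<^bsub>gr 3 G\<^esub>"
      using pow[OF cG, of n] N.rcos_const[OF is_group] by (simp add: gr_3_simps)
    then show "?c \<in> ?H \<and> ?N #> ?c \<in> T"
      using c n(1) unfolding T_def by (auto simp: gr_3_simps(1))
  qed
  ultimately have "generate G (\<Union>x\<in>derived1 G. \<Union>y\<in>carrier G. {x \<otimes> y \<otimes> inv x \<otimes> inv y}) \<subseteq> ?P"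
    by (intro generate_subgroup_incl)
  moreover have "?H = generate G (\<Union>x\<in>derived1 G. \<Union>y\<in>carrier G. {x \<otimes> y \<otimes> inv x \<otimes> inv y})"
  proof -
    have "?H = commutator_subgroup G (lower_central_series G 2) (carrier G)"
      by (simp add: eval_nat_numeral)
    then show ?thesis unfolding lower_central_series_2 commutator_subgroup_def .
  qed
  ultimately have "W \<in> T" using W by (auto simp: gr_3_simps(1))
  then show ?thesis unfolding T_def by blast
qed

theorem proposition5p5:
  fixes G :: "('a, 'b) monoid_scheme" and K :: "('k, 'm) ring_scheme"
  assumes "finitely_generated_group G"
    and "field_characteristic_zero K"
    and "trivial_alexander_action_over K G"
  shows "carrier (tensor (gr 3 G) (add_monoid K)) = {\<one>\<^bsub>tensor (gr 3 G) (add_monoid K)\<^esub>}"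
proof -
  interpret G: group G using assms(1) by (simp add: finitely_generated_group_def)
  interpret K: field K using assms(2) by (simp add: field_characteristic_zero_def)
  show ?thesis
    using G.gr_3_torsion[OF assms(2,3)]
    by (rule torsion_tensor_divisible_trivial[OF G.gr_3_comm_group K.a_comm_group _
          field_characteristic_zero_uniquely_divisible[OF assms(2)]])
qed

end
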